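(* Locally Minimal Defensive Alliance on the planar graphs of minimum degree at least 2 admits a kernel with at most $k^{\mathcal{O}(k^{4})}$ vertices.
   Context: Let $G=(V,E)$ be a finite, simple, undirected graph. For $D\subseteq V$ and $v\in V$, let $d_D(v)$ denote the number of neighbours of $v$ in $D$, and $D^c=V\setminus D$. A non-empty set $D\subseteq V$ is a defensive alliance in $G$ if for each $v\in D$, $d_D(v)+1\geq d_{D^c}(v)$. A defensive alliance $D$ is locally minimal if for every $v\in D$, $D\setminus\{v\}$ is not a defensive alliance. The problem Locally Minimal Defensive Alliance is: given a graph $G$ and an integer $k$, does $G$ have a locally minimal defensive alliance $D$ with $|D|\geq k$? The parameter is the solution size $k$. *)

theory Defs
  imports "HOL-Analysis.Analysis" "HOL-Library.Landau_Symbols"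
begin

section \<open>Graphs and planarity\<close>

type_synonym 'a graph = "'a set \<times> 'a set set"

definition simple_graph :: "'a graph \<Rightarrow> bool" where
  "simple_graph = (\<lambda>(V, E). finite V \<and> (\<forall>e\<in>E. e \<subseteq> V \<and> card e = 2))"

definition deg_in :: "'a set set \<Rightarrow> 'a set \<Rightarrow> 'a \<Rightarrow> nat" where
  "deg_in E D v = card {u \<in> D. {u, v} \<in> E}"

definition min_degree_at_least :: "nat \<Rightarrow> 'a graph \<Rightarrow> bool" where
  "min_degree_at_least d = (\<lambda>(V, E). \<forall>v\<in>V. d \<le> deg_in E V v)"

text \<open>A drawing in the plane without crossings: vertices are distinct points, every edge is a
  simple arc joining its two ends and avoiding all other vertices, and two distinct edges meet
  only in their common ends.\<close>

definition planar :: "'a graph \<Rightarrow> bool" where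
  "planar = (\<lambda>(V, E).
     \<exists>(p :: 'a \<Rightarrow> complex) (\<gamma> :: 'a set \<Rightarrow> real \<Rightarrow> complex).
       inj_on p V \<and>
       (\<forall>e\<in>E. arc (\<gamma> e) \<and> {pathstart (\<gamma> e), pathfinish (\<gamma> e)} = p ` e \<and>
               path_image (\<gamma> e) \<inter> p ` V = p ` e) \<and>
       (\<forall>e\<in>E. \<forall>f\<in>E. e \<noteq> f \<longrightarrow>
               path_image (\<gamma> e) \<inter> path_image (\<gamma> f) = p ` (e \<inter> f)))"


section \<open>Defensive alliances\<close>

definition defensive_alliance :: "'a graph \<Rightarrow> 'a set \<Rightarrow> bool" where
  "defensive_alliance = (\<lambda>(V, E) D.
     D \<subseteq> V \<and> D \<noteq> {} \<and> (\<forall>v\<in>D. deg_in E D v + 1 \<ge> deg_in E (V - D) v))"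

definition locally_minimal_defensive_alliance :: "'a graph \<Rightarrow> 'a set \<Rightarrow> bool" where
  "locally_minimal_defensive_alliance G D \<longleftrightarrow>
     defensive_alliance G D \<and> (\<forall>v\<in>D. \<not> defensive_alliance G (D - {v}))"

definition LMDA :: "('a graph \<times> nat) set" where
  "LMDA = {(G, k). \<exists>D. locally_minimal_defensive_alliance G D \<and> k \<le> card D}"


section \<open>Deterministic multi-tape Turing machines\<close>

text \<open>Tapes are infinite to the right only, and the symbol 0 is the blank. The states are
  \<open>0, \<dots>, tm_states M\<close>, where \<open>0\<close> is the initial state and \<open>tm_states M\<close> is the unique
  halting state; the tape symbols are the numbers below \<open>tm_symbols M\<close>. The values of
  \<open>tm_delta M\<close> outside these finite ranges are never used.\<close>

datatype move = Move_Left | Stay | Move_Right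

record tm =
  tm_tapes :: nat
  tm_symbols :: nat
  tm_states :: nat
  tm_delta :: "nat \<Rightarrow> nat list \<Rightarrow> nat \<times> (nat \<times> move) list"

definition tm_wf :: "tm \<Rightarrow> bool" where
  "tm_wf M \<longleftrightarrow> 1 \<le> tm_tapes M \<and> 4 \<le> tm_symbols M \<and>
     (\<forall>q < tm_states M. \<forall>xs. length xs = tm_tapes M \<longrightarrow> set xs \<subseteq> {..<tm_symbols M} \<longrightarrow>
        (case tm_delta M q xs of (q', acts) \<Rightarrow>
           q' \<le> tm_states M \<and> length acts = tm_tapes M \<and> fst ` set acts \<subseteq> {..<tm_symbols M}))"

type_synonym tape = "(nat \<Rightarrow> nat) \<times> nat"

fun tape_act :: "nat \<times> move \<Rightarrow> tape \<Rightarrow> tape" where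
  "tape_act (s, m) (c, h) =
     (c(h := s), case m of Move_Left \<Rightarrow> h - 1 | Stay \<Rightarrow> h | Move_Right \<Rightarrow> h + 1)"

definition tm_step :: "tm \<Rightarrow> nat \<times> tape list \<Rightarrow> nat \<times> tape list" where
  "tm_step M = (\<lambda>(q, ts).
     if q < tm_states M
     then (case tm_delta M q (map (\<lambda>(c, h). c h) ts) of
             (q', acts) \<Rightarrow> (q', map2 tape_act acts ts))
     else (q, ts))"

definition tape_word :: "nat list \<Rightarrow> nat \<Rightarrow> nat" where
  "tape_word w = (\<lambda>i. if i < length w then w ! i else 0)"

definition tm_init :: "tm \<Rightarrow> nat list \<Rightarrow> nat \<times> tape list" where
  "tm_init M w = (0, (tape_word w, 0) # replicate (tm_tapes M - 1) (tape_word [], 0))"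

text \<open>The first tape holds the input at the start and the output at the end.\<close>

definition tm_outputs_within :: "tm \<Rightarrow> nat list \<Rightarrow> nat list \<Rightarrow> nat \<Rightarrow> bool" where
  "tm_outputs_within M w w' T \<longleftrightarrow>
     (\<exists>t \<le> T. \<exists>ts. (tm_step M ^^ t) (tm_init M w) = (tm_states M, ts) \<and>
                  fst (hd ts) = tape_word w')"

definition poly_time_computable_on ::
  "('i \<Rightarrow> nat list) \<Rightarrow> 'i set \<Rightarrow> ('i \<Rightarrow> 'i) \<Rightarrow> bool" where
  "poly_time_computable_on enc X F \<longleftrightarrow>
     (\<exists>M c d. tm_wf M \<and>
        (\<forall>x\<in>X. tm_outputs_within M (enc x) (enc (F x)) (c * length (enc x) ^ d + c)))"

definition computable_nat_fun :: "(nat \<Rightarrow> nat) \<Rightarrow> bool" where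
  "computable_nat_fun g \<longleftrightarrow>
     (\<exists>M. tm_wf M \<and> (\<forall>k. \<exists>T. tm_outputs_within M (replicate k 2) (replicate (g k) 2) T))"


section \<open>Kernelization\<close>

text \<open>\<open>X\<close> is the set of admissible instances (with parameter as second component) and \<open>L\<close> the
  set of yes-instances. The function \<open>enc\<close> encodes the parameter in unary, so the length of an
  encoding accounts for both the instance and its parameter.\<close>

definition kernelization ::
  "('i \<times> nat \<Rightarrow> nat list) \<Rightarrow> ('i \<times> nat) set \<Rightarrow> ('i \<times> nat) set \<Rightarrow>
   ('i \<times> nat \<Rightarrow> 'i \<times> nat) \<Rightarrow> bool" where
  "kernelization enc X L K \<longleftrightarrow>
     poly_time_computable_on enc X K \<and>
     (\<forall>x\<in>X. K x \<in> X \<and> (K x \<in> L \<longleftrightarrow> x \<in> L)) \<and>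
     (\<exists>g. computable_nat_fun g \<and> (\<forall>x\<in>X. length (enc (K x)) \<le> g (snd x)))"

text \<open>An instance is encoded as the parameter in unary, the number of vertices in unary, and the
  adjacency matrix row by row; 1 and 2 stand for the bits zero and one, and 3 is a separator.\<close>

definition enc_instance :: "nat graph \<times> nat \<Rightarrow> nat list" where
  "enc_instance = (\<lambda>((V, E), k). let n = card V in
     replicate k 2 @ [3] @ replicate n 2 @ [3] @
     concat (map (\<lambda>i. map (\<lambda>j. if {i, j} \<in> E then 2 else 1) [0..<n]) [0..<n]))"

definition planar_mindeg2_instances :: "(nat graph \<times> nat) set" where
  "planar_mindeg2_instances =
     {(G, k). simple_graph G \<and> fst G = {..<card (fst G)} \<and> planar G \<and> min_degree_at_least 2 G}"

definition admits_kernel_with_vertices ::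
  "(nat graph \<times> nat) set \<Rightarrow> (nat graph \<times> nat) set \<Rightarrow> (nat \<Rightarrow> nat) \<Rightarrow> bool" where
  "admits_kernel_with_vertices X L f \<longleftrightarrow>
     (\<exists>K. kernelization enc_instance X L K \<and>
          (\<forall>(G, k)\<in>X. card (fst (fst (K (G, k)))) \<le> f k))"

end

theory Submission imports Defs begin

text \<open>A graph of minimum degree at least 2 without a locally minimal
  defensive alliance of size \<open>k\<close> has at most \<open>k ^ 3\<close> vertices. Take a largest locally minimal
  alliance \<open>S\<close> and let \<open>L\<close> be the set of vertices of degree at most \<open>2 * k - 2\<close> in its closed
  neighbourhood. Vertices of larger degree lie in no alliance with fewer than \<open>k\<close> vertices, so a
  locally minimal alliance avoiding \<open>L\<close> would avoid the whole closed neighbourhood of \<open>S\<close>, and its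
  union with \<open>S\<close> would be a larger locally minimal alliance. Hence the complement of \<open>L\<close> contains
  no alliance at all, which makes it at most half as large as the number of edges leaving \<open>L\<close>. The
  kernel replaces every instance with at least \<open>(k + 2) ^ 3\<close> vertices by a triangle with
  parameter 0.\<close>

section \<open>Locally minimal defensive alliances\<close>

lemma no_loop:
  assumes "simple_graph (V, E)"
  shows "{v, v} \<notin> E"
  using assms by (force simp: simple_graph_def)

lemma deg_in_Un_disjoint:
  assumes "finite A" "finite B" "A \<inter> B = {}"
  shows "deg_in E (A \<union> B) v = deg_in E A v + deg_in E B v"
proof -
  have "{u \<in> A \<union> B. {u, v} \<in> E} = {u \<in> A. {u, v} \<in> E} \<union> {u \<in> B. {u, v} \<in> E}"
    by auto
  then show ?thesis
    using assms unfolding deg_in_def by (simp, intro card_Un_disjoint) auto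
qed

lemma deg_in_mono:
  assumes "finite B" "A \<subseteq> B"
  shows "deg_in E A v \<le> deg_in E B v"
  unfolding deg_in_def using assms by (intro card_mono) auto

lemma deg_in_split:
  assumes "finite V" "D \<subseteq> V"
  shows "deg_in E V v = deg_in E D v + deg_in E (V - D) v"
proof -
  have "D \<union> (V - D) = V" using assms by auto
  then show ?thesis
    using assms deg_in_Un_disjoint[of D "V - D" E v] finite_subset by fastforce
qed

lemma deg_in_eq_sum:
  assumes "finite D"
  shows "deg_in E D v = (\<Sum>u\<in>D. of_bool ({u, v} \<in> E))"
  using assms unfolding deg_in_def by (simp add: of_bool_def sum.If_cases Int_def)

lemma sum_deg_in_swap:
  assumes "finite X" "finite Y"
  shows "(\<Sum>v\<in>X. deg_in E Y v) = (\<Sum>v\<in>Y. deg_in E X v)"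
proof -
  have "(\<Sum>v\<in>X. deg_in E Y v) = (\<Sum>v\<in>X. \<Sum>u\<in>Y. of_bool ({v, u} \<in> E))"
    using assms by (intro sum.cong) (simp_all only: deg_in_eq_sum insert_commute)
  also have "\<dots> = (\<Sum>u\<in>Y. \<Sum>v\<in>X. of_bool ({v, u} \<in> E))" by (rule sum.swap)
  also have "\<dots> = (\<Sum>u\<in>Y. deg_in E X u)"
    using assms by (intro sum.cong) (simp_all only: deg_in_eq_sum)
  finally show ?thesis .
qed

section \<open>Existence of locally minimal alliances, edge boundaries and degree bounds\<close>

text \<open>A sub-alliance of least cardinality works, since deleting a vertex cannot give a smaller
  one.\<close>

lemma defensive_alliance_contains_locally_minimal:
  assumes "finite D" "defensive_alliance G D"
  obtains D' where "D' \<subseteq> D" "locally_minimal_defensive_alliance G D'"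
proof -
  let ?P = "\<lambda>D'. D' \<subseteq> D \<and> defensive_alliance G D'"
  obtain D' where D': "?P D'" and min: "\<And>Y. ?P Y \<Longrightarrow> card D' \<le> card Y"
    using assms(2) arg_min_nat_lemma[of ?P D card] by blast
  have "\<not> defensive_alliance G (D' - {v})" if "v \<in> D'" for v
  proof
    assume "defensive_alliance G (D' - {v})"
    then have "card D' \<le> card (D' - {v})" using min D' by blast
    moreover have "finite D'" using D' assms(1) finite_subset by blast
    ultimately show False using card_Diff1_less[of D' v] that by simp
  qed
  then show thesis using that D' unfolding locally_minimal_defensive_alliance_def by blast
qed

text \<open>If \<open>X\<close> contains no alliance, its vertices can be peeled off one by one, each having at
  least two more neighbours outside the current set than inside; so every step shrinks the edge
  boundary by at least two.\<close>

lemma edge_boundary_ge_if_no_alliance: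
  assumes G: "simple_graph (V, E)" and "X \<subseteq> V"
    and "\<And>Y. Y \<subseteq> X \<Longrightarrow> \<not> defensive_alliance (V, E) Y"
  shows "2 * card X \<le> (\<Sum>v\<in>X. deg_in E (V - X) v)"
  using assms(2,3)
proof (induction "card X" arbitrary: X)
  case 0
  then show ?case using G by simp
next
  case (Suc n)
  have fin: "finite V" using G by (simp add: simple_graph_def)
  then have finX: "finite X" using Suc.prems(1) finite_subset by blast
  have "X \<noteq> {}" using Suc.hyps(2) by auto
  then obtain v where v: "v \<in> X" "deg_in E X v + 2 \<le> deg_in E (V - X) v"
    using Suc.prems(1) Suc.prems(2)[of X] by (force simp: defensive_alliance_def)
  define X' where "X' = X - {v}"
  have X: "X = insert v X'" "v \<notin> X'" "finite X'" using v finX by (auto simp: X'_def)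
  have "card X' = n" using X Suc.hyps(2) by simp
  then have IH: "2 * card X' \<le> (\<Sum>u\<in>X'. deg_in E (V - X') u)"
    using Suc.hyps(1)[of X'] Suc.prems X(1) by blast
  \<comment> \<open>Moving \<open>v\<close> outside gives each neighbour of \<open>v\<close> in
    \<open>X'\<close> one more outside neighbour. The boundary thus loses
    \<open>deg_in E (V - X) v\<close> edges and gains only \<open>deg_in E X' v\<close>, a net loss
    of at least two.\<close>
  have "deg_in E (V - X') u = deg_in E (V - X) u + of_bool ({u, v} \<in> E)" for u
  proof -
    have "V - X' = (V - X) \<union> {v}" using X Suc.prems(1) by auto
    moreover have "deg_in E {v} u = of_bool ({u, v} \<in> E)"
      by (simp add: deg_in_eq_sum insert_commute)
    ultimately show ?thesis using deg_in_Un_disjoint[of "V - X" "{v}" E u] fin v(1) by simp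
  qed
  then have "(\<Sum>u\<in>X'. deg_in E (V - X') u) = (\<Sum>u\<in>X'. deg_in E (V - X) u) + deg_in E X' v"
    using X(3) by (simp add: sum.distrib deg_in_eq_sum[of X'])
  moreover have "deg_in E X' v \<le> deg_in E X v"
    using finX X(1) by (intro deg_in_mono) auto
  ultimately show ?case using IH v X by simp
qed

text \<open>Without loops \<open>v\<close> does not count itself, so it has at most
  \<open>card D - 1\<close> neighbours in \<open>D\<close>; the alliance condition then bounds the
  outside degree, and the two bounds add up.\<close>

lemma alliance_degree_bounds:
  assumes G: "simple_graph (V, E)" and D: "defensive_alliance (V, E) D" and v: "v \<in> D"
  shows "deg_in E D v < card D" "deg_in E (V - D) v \<le> card D" "deg_in E V v + 1 \<le> 2 * card D"
proof -
  have fin: "finite V" "finite D" "D \<subseteq> V"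
    using G D finite_subset by (auto simp: simple_graph_def defensive_alliance_def)
  have "{u \<in> D. {u, v} \<in> E} \<subset> D" using no_loop[OF G] v by blast
  then show 1: "deg_in E D v < card D" unfolding deg_in_def using fin by (intro psubset_card_mono)
  show 2: "deg_in E (V - D) v \<le> card D" using 1 D v by (fastforce simp: defensive_alliance_def)
  show "deg_in E V v + 1 \<le> 2 * card D" using 1 2 deg_in_split[OF fin(1,3), of E v] by simp
qed

section \<open>Unions of non-adjacent locally minimal alliances\<close>

text \<open>The point is that \<open>D - {v}\<close> must fail for a reason that survives adding
  \<open>S\<close>. Minimum degree 2 makes \<open>D - {v}\<close> non-empty, so the failure is a
  violated inequality at some \<open>u\<close> in \<open>D\<close>; as \<open>u\<close> has no
  neighbour in \<open>S\<close>, the violation persists.\<close>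

lemma locally_minimal_alliance_Un_step:
  assumes G: "simple_graph (V, E)" and deg: "min_degree_at_least 2 (V, E)"
    and D: "locally_minimal_defensive_alliance (V, E) D" and S: "S \<subseteq> V"
    and sep: "\<And>u w. u \<in> D \<Longrightarrow> w \<in> S \<Longrightarrow> u \<noteq> w \<and> {u, w} \<notin> E" and v: "v \<in> D"
  shows "deg_in E (V - (D \<union> S)) v \<le> deg_in E (D \<union> S) v + 1"
    and "\<not> defensive_alliance (V, E) ((D \<union> S) - {v})"
proof -
  have DA: "defensive_alliance (V, E) D" using D by (simp add: locally_minimal_defensive_alliance_def)
  have fin: "finite V" "D \<subseteq> V"
    using G DA by (auto simp: simple_graph_def defensive_alliance_def)
  then have finD: "finite D" using finite_subset by blast
  have "deg_in E (V - (D \<union> S)) v \<le> deg_in E (V - D) v"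
    using fin by (intro deg_in_mono) auto
  also have "\<dots> \<le> deg_in E D v + 1" using DA v by (auto simp: defensive_alliance_def)
  also have "deg_in E D v \<le> deg_in E (D \<union> S) v"
    using fin S finite_subset by (intro deg_in_mono) blast+
  finally show "deg_in E (V - (D \<union> S)) v \<le> deg_in E (D \<union> S) v + 1" by simp
  \<comment> \<open>With no neighbour in \<open>D\<close>, the vertex \<open>v\<close> could have at
    most one outside, hence total degree at most 1.\<close>
  have "2 \<le> deg_in E V v" using deg v fin by (auto simp: min_degree_at_least_def)
  then have "deg_in E D v \<noteq> 0"
    using deg_in_split[OF fin, of E v] DA v by (fastforce simp: defensive_alliance_def)
  then obtain w where w: "w \<in> D" "{w, v} \<in> E" unfolding deg_in_def by (auto simp: finD)
  then have "w \<in> D - {v}" using no_loop[OF G] by auto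
  moreover have "\<not> defensive_alliance (V, E) (D - {v})"
    using D v by (simp add: locally_minimal_defensive_alliance_def)
  ultimately obtain u where u: "u \<in> D - {v}"
    "\<not> deg_in E (V - (D - {v})) u \<le> deg_in E (D - {v}) u + 1"
    using fin by (auto simp: defensive_alliance_def)
  have "{x, u} \<notin> E" if "x \<in> S" for x
    using sep[of u x] u(1) that by (simp add: insert_commute)
  then have "{x \<in> D \<union> S - {v}. {x, u} \<in> E} = {x \<in> D - {v}. {x, u} \<in> E}"
    "{x \<in> V - (D \<union> S - {v}). {x, u} \<in> E} = {x \<in> V - (D - {v}). {x, u} \<in> E}"
    by auto
  then have "\<not> deg_in E (V - (D \<union> S - {v})) u \<le> deg_in E (D \<union> S - {v}) u + 1"
    using u(2) by (simp add: deg_in_def)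
  then show "\<not> defensive_alliance (V, E) ((D \<union> S) - {v})"
    using u(1) by (auto simp: defensive_alliance_def)
qed

lemma locally_minimal_alliance_Un:
  assumes "simple_graph (V, E)" "min_degree_at_least 2 (V, E)"
    and D: "locally_minimal_defensive_alliance (V, E) D"
    and S: "locally_minimal_defensive_alliance (V, E) S"
    and sep: "\<And>u w. u \<in> D \<Longrightarrow> w \<in> S \<Longrightarrow> u \<noteq> w \<and> {u, w} \<notin> E"
  shows "locally_minimal_defensive_alliance (V, E) (D \<union> S)"
proof -
  have sub: "D \<subseteq> V" "S \<subseteq> V" "D \<noteq> {}"
    using D S by (auto simp: locally_minimal_defensive_alliance_def defensive_alliance_def)
  have sep': "u \<noteq> w \<and> {u, w} \<notin> E" if "u \<in> S" "w \<in> D" for u w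
    using sep[OF that(2,1)] by (auto simp: insert_commute)
  note 1 = locally_minimal_alliance_Un_step[OF assms(1,2) D sub(2) sep]
  note 2 = locally_minimal_alliance_Un_step[OF assms(1,2) S sub(1) sep', unfolded Un_commute[of S D]]
  show ?thesis
    unfolding locally_minimal_defensive_alliance_def
  proof (intro conjI ballI)
    show "defensive_alliance (V, E) (D \<union> S)"
      using 1(1) 2(1) sub by (auto simp: defensive_alliance_def)
    show "\<not> defensive_alliance (V, E) (D \<union> S - {v})" if "v \<in> D \<union> S" for v
      using that 1(2) 2(2) by blast
  qed
qed

section \<open>The cubic bound on the number of vertices\<close>

lemma whole_graph_defensive_alliance:
  assumes "V \<noteq> {}"
  shows "defensive_alliance (V, E) V"
proof -
  have "deg_in E {} v = 0" for v by (simp add: deg_in_def)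
  then show ?thesis using assms by (simp add: defensive_alliance_def)
qed

text \<open>With \<open>k = j + 1\<close>, the closed neighbourhood of \<open>S\<close> has at most
  \<open>j + j * j\<close> vertices, hence so has \<open>L\<close>. At most
  \<open>2 * j * card L\<close> edges leave \<open>L\<close>, so
  \<open>card (V - L) \<le> j * card L\<close> and
  \<open>card V \<le> (j + j * j) * k = j * k ^ 2\<close>.\<close>

lemma card_le_cube_if_no_large_alliance:
  assumes G: "simple_graph (V, E)" and deg: "min_degree_at_least 2 (V, E)"
    and small: "\<And>D. locally_minimal_defensive_alliance (V, E) D \<Longrightarrow> card D < k"
  shows "card V \<le> k ^ 3"
proof (cases "V = {}")
  case False
  have fin: "finite V" using G by (simp add: simple_graph_def)
  let ?LM = "locally_minimal_defensive_alliance (V, E)"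
  obtain D0 where "?LM D0"
    using defensive_alliance_contains_locally_minimal[OF fin whole_graph_defensive_alliance[OF False]]
    by blast
  then obtain S where S: "?LM S" and S_max: "\<And>D. ?LM D \<Longrightarrow> card D \<le> card S"
    using ex_has_greatest_nat[of ?LM D0 card k] small less_imp_le by blast
  have S_DA: "defensive_alliance (V, E) S"
    using S by (simp add: locally_minimal_defensive_alliance_def)
  then have SV: "S \<subseteq> V" "S \<noteq> {}" by (auto simp: defensive_alliance_def)
  have finS: "finite S" using SV fin finite_subset by blast
  have "card S \<noteq> 0" using SV finS by simp
  \<comment> \<open>\<open>j\<close> bounds the size of every locally minimal alliance, so the
    degree threshold \<open>2 * k - 2\<close> becomes \<open>2 * j\<close>.\<close>
  with small[OF S] obtain j where k: "k = Suc j" and j: "card S \<le> j" "0 < j"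
    by (cases k) auto
  define N where "N = S \<union> (\<Union>s\<in>S. {u \<in> V - S. {u, s} \<in> E})"
  define L where "L = {x \<in> N. deg_in E V x \<le> 2 * j}"
  have NV: "N \<subseteq> V" "L \<subseteq> V" using SV by (auto simp: N_def L_def)
  have finN: "finite N" "finite L" using NV fin finite_subset by blast+
  have "card (\<Union>s\<in>S. {u \<in> V - S. {u, s} \<in> E}) \<le> (\<Sum>s\<in>S. card {u \<in> V - S. {u, s} \<in> E})"
    using finS by (rule card_UN_le)
  also have "\<dots> \<le> (\<Sum>s\<in>S. card S)"
    using alliance_degree_bounds(2)[OF G S_DA] by (intro sum_mono) (simp add: deg_in_def)
  finally have "card N \<le> card S + card S * card S"
    unfolding N_def by (intro order.trans[OF card_Un_le] add_left_mono) simp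
  also have "\<dots> \<le> j + j * j" using j by (intro add_mono mult_mono) auto
  finally have "card L \<le> j + j * j"
    using card_mono[OF finN(1), of L] by (fastforce simp: L_def)
  have "\<not> defensive_alliance (V, E) Y" if Y: "Y \<subseteq> V - L" for Y
  proof
    assume "defensive_alliance (V, E) Y"
    moreover have "finite Y" using Y fin finite_subset by blast
    ultimately obtain D where D: "D \<subseteq> Y" "?LM D"
      using defensive_alliance_contains_locally_minimal by blast
    then have D_DA: "defensive_alliance (V, E) D"
      by (simp add: locally_minimal_defensive_alliance_def)
    then have DV: "D \<subseteq> V" "D \<noteq> {}" by (auto simp: defensive_alliance_def)
    have finD: "finite D" using DV fin finite_subset by blast
    have "deg_in E V u \<le> 2 * j" if "u \<in> D" for u
      using alliance_degree_bounds(3)[OF G D_DA that] small[OF D(2)] k by simp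
    then have DN: "D \<inter> N = {}" using D(1) Y by (auto simp: L_def)
    then have "u \<noteq> w \<and> {u, w} \<notin> E" if "u \<in> D" "w \<in> S" for u w
      using that DV by (auto simp: N_def)
    then have "?LM (D \<union> S)" by (rule locally_minimal_alliance_Un[OF G deg D(2) S])
    then have "card (D \<union> S) \<le> card S" by (rule S_max)
    moreover have "card (D \<union> S) = card D + card S"
      using DN finD finS by (intro card_Un_disjoint) (auto simp: N_def)
    ultimately show False using DV finD by simp
  qed
  then have "2 * card (V - L) \<le> (\<Sum>v\<in>V - L. deg_in E (V - (V - L)) v)"
    by (intro edge_boundary_ge_if_no_alliance[OF G]) auto
  \<comment> \<open>The boundary edges are recounted from the side of \<open>L\<close>, where
    degrees are bounded.\<close>
  also have "\<dots> = (\<Sum>v\<in>L. deg_in E (V - L) v)"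
    using NV fin finN by (subst sum_deg_in_swap) (auto simp: double_diff)
  also have "\<dots> \<le> (\<Sum>v\<in>L. 2 * j)"
  proof (rule sum_mono)
    fix v assume "v \<in> L"
    then have "deg_in E V v \<le> 2 * j" by (simp add: L_def)
    then show "deg_in E (V - L) v \<le> 2 * j"
      using deg_in_mono[of V "V - L" E v] fin by fastforce
  qed
  finally have "card (V - L) \<le> card L * j" by simp
  moreover have "card V = card L + card (V - L)"
    using NV fin finN by (simp add: card_Diff_subset card_mono)
  ultimately have "card V \<le> card L * k" by (simp add: k)
  also have "\<dots> \<le> (j + j * j) * k" using \<open>card L \<le> _\<close> by (rule mult_right_mono) simp
  also have "\<dots> \<le> k ^ 3" by (simp add: k power3_eq_cube algebra_simps)
  finally show ?thesis .
qed simp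

section \<open>The triangle as a trivial yes-instance\<close>

definition triangle_graph :: "nat graph" where
  "triangle_graph = ({..<3}, {{0, 1}, {0, 2}, {1, 2}})"

lemma lessThan_3: "{..<3::nat} = {0, 1, 2}"
  by auto

text \<open>The drawing is the right triangle with corners 0, 1 and \<open>\<i>\<close>. Describing
  its sides by real and imaginary parts turns their intersections into linear conditions.\<close>

lemma planar_triangle: "planar triangle_graph"
proof -
  define p :: "nat \<Rightarrow> complex" where "p i = (if i = 0 then 0 else if i = 1 then 1 else \<i>)" for i
  define \<gamma> where
    "\<gamma> e = (if e = {0, 1} then linepath 0 1 else if e = {0, 2} then linepath 0 \<i> else linepath 1 \<i>)"
    for e :: "nat set"
  have ne: "{0, 1} \<noteq> {0, 2::nat}" "{0, 1} \<noteq> {1, 2::nat}" "{0, 2} \<noteq> {1, 2::nat}"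
    by (auto simp: doubleton_eq_iff)
  have g: "\<gamma> {0, 1} = linepath 0 1" "\<gamma> {0, 2} = linepath 0 \<i>" "\<gamma> {1, 2} = linepath 1 \<i>"
    using ne by (auto simp: \<gamma>_def)
  have s1: "closed_segment 0 (1::complex) = {z. Im z = 0 \<and> 0 \<le> Re z \<and> Re z \<le> 1}"
  proof (intro subset_antisym subsetI)
    fix z assume "z \<in> closed_segment 0 (1::complex)"
    then show "z \<in> {z. Im z = 0 \<and> 0 \<le> Re z \<and> Re z \<le> 1}" by (auto simp: in_segment)
  next
    fix z assume "z \<in> {z. Im z = 0 \<and> 0 \<le> Re z \<and> Re z \<le> 1}"
    then show "z \<in> closed_segment 0 (1::complex)"
      by (auto simp: in_segment complex_eq_iff intro!: exI[of _ "Re z"])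
  qed
  have s2: "closed_segment 0 \<i> = {z. Re z = 0 \<and> 0 \<le> Im z \<and> Im z \<le> 1}"
  proof (intro subset_antisym subsetI)
    fix z assume "z \<in> closed_segment 0 \<i>"
    then show "z \<in> {z. Re z = 0 \<and> 0 \<le> Im z \<and> Im z \<le> 1}" by (auto simp: in_segment)
  next
    fix z assume "z \<in> {z. Re z = 0 \<and> 0 \<le> Im z \<and> Im z \<le> 1}"
    then show "z \<in> closed_segment 0 \<i>"
      by (auto simp: in_segment complex_eq_iff intro!: exI[of _ "Im z"])
  qed
  have s3: "closed_segment 1 \<i> = {z. Re z + Im z = 1 \<and> 0 \<le> Im z \<and> Im z \<le> 1}"
  proof (intro subset_antisym subsetI)
    fix z assume "z \<in> closed_segment 1 \<i>"
    then show "z \<in> {z. Re z + Im z = 1 \<and> 0 \<le> Im z \<and> Im z \<le> 1}" by (auto simp: in_segment)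
  next
    fix z assume "z \<in> {z. Re z + Im z = 1 \<and> 0 \<le> Im z \<and> Im z \<le> 1}"
    then show "z \<in> closed_segment 1 \<i>"
      by (auto simp: in_segment complex_eq_iff intro!: exI[of _ "Im z"])
  qed
  have int: "{0, 1} \<inter> {0, 2} = {0::nat}" "{0, 1} \<inter> {1, 2} = {1::nat}" "{0, 2} \<inter> {1, 2} = {2::nat}"
    by auto
  have seg: "closed_segment 0 1 \<inter> closed_segment 0 \<i> = {0}"
    "closed_segment 0 1 \<inter> closed_segment 1 \<i> = {1}"
    "closed_segment 0 \<i> \<inter> closed_segment 1 \<i> = {\<i>}"
    by (auto simp: s1 s2 s3 complex_eq_iff)
  have p: "p 0 = 0" "p 1 = 1" "p 2 = \<i>" by (auto simp: p_def)
  \<comment> \<open>The simplifier turns the natural number 1 into \<open>Suc 0\<close>, so this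
    form is kept as well.\<close>
  note pS = p(2)[unfolded One_nat_def]
  show ?thesis
    unfolding planar_def triangle_graph_def lessThan_3 prod.case
  proof (rule exI[of _ p], rule exI[of _ \<gamma>], intro conjI)
    show "inj_on p {0, 1, 2}" by (simp add: inj_on_def p pS)
    show "\<forall>e\<in>{{0, 1}, {0, 2}, {1, 2}}. arc (\<gamma> e) \<and> {pathstart (\<gamma> e), pathfinish (\<gamma> e)} = p ` e \<and>
               path_image (\<gamma> e) \<inter> p ` {0, 1, 2} = p ` e"
      by (simp only: ball_simps g)
         (auto simp: p pS s1 s2 s3 intro!: arc_linepath)
    show "\<forall>e\<in>{{0, 1}, {0, 2}, {1, 2}}. \<forall>f\<in>{{0, 1}, {0, 2}, {1, 2}}. e \<noteq> f \<longrightarrow>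
               path_image (\<gamma> e) \<inter> path_image (\<gamma> f) = p ` (e \<inter> f)"
      by (simp only: ball_simps g path_image_linepath int int[THEN trans[OF Int_commute]]
        seg seg[THEN trans[OF Int_commute]] p image_insert image_empty simp_thms)
  qed
qed

lemma triangle_mindeg: "simple_graph triangle_graph" "min_degree_at_least 2 triangle_graph"
proof -
  show "simple_graph triangle_graph" by (auto simp: simple_graph_def triangle_graph_def)
  have "card {u. (u = 0 \<or> u = 1 \<or> u = 2) \<and> {u, v} \<in> {{0, 1}, {0, 2}, {1, 2}}} = 2" 
    if "v \<in> {0, 1, 2}" for v :: nat
  proof -
    have "{u. (u = 0 \<or> u = 1 \<or> u = 2) \<and> {u, v} \<in> {{0, 1}, {0, 2}, {1, 2}}} = {0, 1, 2} - {v}"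
      using that by (auto simp: doubleton_eq_iff)
    then show ?thesis using that by auto
  qed
  then show "min_degree_at_least 2 triangle_graph"
    by (simp add: min_degree_at_least_def triangle_graph_def deg_in_def lessThan_3)
qed

text \<open>Empty parameter, separator, three vertices, separator, then the matrix rows 122, 212,
  221.\<close>

definition triangle_code :: "nat list" where
  "triangle_code = [3, 2, 2, 2, 3, 1, 2, 2, 2, 1, 2, 2, 2, 1]"

lemma enc_triangle: "enc_instance (triangle_graph, 0) = triangle_code"
proof -
  have "[0..<3] = [0, 1, 2::nat]" by (simp add: upt_rec)
  then show ?thesis
    by (simp add: enc_instance_def triangle_graph_def triangle_code_def doubleton_eq_iff eval_nat_numeral(2,3))
qed

section \<open>The Turing machine\<close>

text \<open>The machine compares the number of vertices with \<open>(k + 2) ^ c\<close> in real time, using a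
  reflected odometer: each of \<open>c\<close> heads runs back and forth over its own copy of \<open>k\<close> in unary,
  and whenever it would run off an end, it turns round and the next head moves instead. The two
  directions are 0 (left) and 1 (right); each is stored on a tape of its own, whose head never
  moves.\<close>

definition unary_tape :: "nat \<Rightarrow> nat \<Rightarrow> nat" where
  "unary_tape k = (\<lambda>i. if i = 0 then 3 else if i \<le> k then 2 else 0)"

definition direction_tape :: "bool \<Rightarrow> nat \<Rightarrow> nat" where
  "direction_tape b = (\<lambda>i. if i = 0 \<and> b then 1 else 0)"

fun counter_tapes :: "nat \<Rightarrow> (bool \<times> nat) list \<Rightarrow> tape list" where
  "counter_tapes k [] = []"
| "counter_tapes k ((b, p) # cs) = (unary_tape k, p) # (direction_tape b, 0) # counter_tapes k cs"

text \<open>Here \<open>m\<close> is the last position, namely the blank cell \<open>k + 1\<close>.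
  A head first finishes its current sweep; every tick of the later heads is a turn of this one,
  followed by a full sweep of \<open>m\<close> moves.\<close>

fun ticks_left :: "nat \<Rightarrow> (bool \<times> nat) list \<Rightarrow> nat" where
  "ticks_left m [] = 0"
| "ticks_left m ((b, p) # cs) = (if b then m - p else p) + Suc m * ticks_left m cs"

abbreviation read_tapes :: "tape list \<Rightarrow> nat list" where
  "read_tapes \<equiv> map (\<lambda>(c, h). c h)"

definition keep :: "nat list \<Rightarrow> (nat \<times> move) list" where
  "keep = map (\<lambda>s. (s, Stay))"

text \<open>A head moving left is blocked by the marker 3, one moving right by the blank. On symbols
  read from counter tapes, \<open>None\<close> means that every head is blocked, so the odometer has
  run out.\<close>

fun tick :: "nat list \<Rightarrow> (nat \<times> move) list option" where
  "tick (s # d # xs) =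
     (if (if d = 0 then s = 3 else s = 0)
      then map_option (\<lambda>acts. (s, Stay) # (1 - d, Stay) # acts) (tick xs)
      else Some ((s, if d = 0 then Move_Left else Move_Right) # (d, Stay) # keep xs))"
| "tick _ = None"

lemma map2_tape_act_keep [simp]: "map2 tape_act (keep (read_tapes ts)) ts = ts"
  unfolding keep_def by (induction ts) auto

lemma keep_Cons [simp]: "keep (x # xs) = (x, Stay) # keep xs"
  by (simp add: keep_def)

lemma length_keep [simp]: "length (keep xs) = length xs"
  by (simp add: keep_def)

lemma fst_set_keep [simp]: "fst ` set (keep xs) = set xs"
  by (force simp: keep_def)

lemma tick_wf:
  "tick xs = Some acts \<Longrightarrow> even (length xs) \<Longrightarrow> set xs \<subseteq> {..<4} \<Longrightarrow>
   length acts = length xs \<and> fst ` set acts \<subseteq> {..<4}"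
  by (induction xs arbitrary: acts rule: tick.induct)
    (auto simp: image_subset_iff keep_def split: if_splits, force)

lemma tick_eq_None_iff:
  assumes "snd ` set cs \<subseteq> {..Suc k}"
  shows "tick (read_tapes (counter_tapes k cs)) = None \<longleftrightarrow> ticks_left (Suc k) cs = 0"
  using assms by (induction k cs rule: counter_tapes.induct)
    (auto simp: unary_tape_def direction_tape_def)

text \<open>A turn raises the head's own term from 0 to \<open>Suc k\<close> while the later heads
  lose one tick, worth \<open>Suc (Suc k)\<close>; an ordinary move only lowers the own term by
  one.\<close>

lemma tick_counter_tapes:
  assumes "snd ` set cs \<subseteq> {..Suc k}" "tick (read_tapes (counter_tapes k cs)) = Some acts"
  shows "\<exists>cs'. map2 tape_act acts (counter_tapes k cs) = counter_tapes k cs' \<and>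
           snd ` set cs' \<subseteq> {..Suc k} \<and> Suc (ticks_left (Suc k) cs') = ticks_left (Suc k) cs"
  using assms
proof (induction k cs arbitrary: acts rule: counter_tapes.induct)
  case (2 k b p cs)
  have p: "p \<le> Suc k" using "2.prems"(1) by auto
  have un: "unary_tape k p = 3 \<longleftrightarrow> p = 0" "unary_tape k p = 0 \<longleftrightarrow> p = Suc k"
    using p by (auto simp: unary_tape_def)
  show ?case
  proof (cases "if b then p = Suc k else p = 0")
    case True
    then obtain acts' where acts': "tick (read_tapes (counter_tapes k cs)) = Some acts'"
      "acts = (unary_tape k p, Stay) # (1 - direction_tape b 0, Stay) # acts'"
      using "2.prems"(2) un by (auto simp: direction_tape_def split: if_splits)
    then obtain cs' where cs': "map2 tape_act acts' (counter_tapes k cs) = counter_tapes k cs'"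
      "snd ` set cs' \<subseteq> {..Suc k}" "Suc (ticks_left (Suc k) cs') = ticks_left (Suc k) cs"
      using "2.IH" "2.prems"(1) by (metis image_mono order_trans set_subset_Cons)
    have "(direction_tape b)(0 := 1 - direction_tape b 0) = direction_tape (\<not> b)"
      by (auto simp: direction_tape_def)
    then show ?thesis
      using True p cs' acts'(2) by (intro exI[of _ "(\<not> b, p) # cs'"]) (auto simp flip: cs'(3))
  next
    case False
    then have "acts = (unary_tape k p, if b then Move_Right else Move_Left) #
        (direction_tape b 0, Stay) # keep (read_tapes (counter_tapes k cs))"
      using "2.prems"(2) un by (auto simp: direction_tape_def split: if_splits)
    then show ?thesis
      using False p "2.prems"(1)
      by (intro exI[of _ "(b, if b then p + 1 else p - 1) # cs"]) auto
  qed
qed simp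

text \<open>This is the number whose \<open>c\<close> digits in base \<open>m + 1\<close> all equal
  \<open>m\<close>.\<close>

lemma ticks_left_replicate: "Suc (ticks_left m (replicate c (False, m))) = Suc m ^ c"
proof (induction c)
  case (Suc c)
  have "Suc (ticks_left m (replicate (Suc c) (False, m))) =
      Suc m * Suc (ticks_left m (replicate c (False, m)))" by simp
  then show ?case using Suc by simp
qed simp

definition write_counters :: "nat \<Rightarrow> nat \<Rightarrow> (nat \<times> move) list" where
  "write_counters c s = concat (replicate c [(s, Move_Right), (0, Stay)])"

lemma length_write_counters [simp]: "length (write_counters c s) = 2 * c"
  unfolding write_counters_def by (induction c) auto

lemma fst_set_write_counters: "fst ` set (write_counters c s) \<subseteq> {s, 0}"
  unfolding write_counters_def by (induction c) auto

lemma write_counters_blank: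
  "map2 tape_act (write_counters c 3) (replicate (2 * c) (tape_word [], 0)) =
   counter_tapes 0 (replicate c (False, 1))"
  unfolding write_counters_def
  by (induction c) (auto simp: tape_word_def unary_tape_def direction_tape_def)

text \<open>Each head stays on the blank cell just past its copy and faces left, so the end of
  copying is the start of the countdown.\<close>

lemma write_counters_copy:
  "map2 tape_act (write_counters c 2) (counter_tapes i (replicate c (False, Suc i))) =
   counter_tapes (Suc i) (replicate c (False, Suc (Suc i)))"
  unfolding write_counters_def
  by (induction c) (auto simp: unary_tape_def direction_tape_def)

text \<open>State 0 writes end markers and state 1 copies the parameter to the counters. On an encoded
  instance the run proceeds to state 2, which advances the counters once per vertex: it halts if the
  vertices end first, and if the counters run out first, states 4 to 19 rewind, write the code of the
  triangle and erase the rest. On a word of symbols 2 only, the run proceeds to state 3, which appends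
  one symbol 2 per counter step. The head of the second tape follows that of the first tape, so that
  the left end of the first tape can be recognised.\<close>

fun kernel_delta :: "nat \<Rightarrow> nat \<Rightarrow> nat list \<Rightarrow> nat \<times> (nat \<times> move) list" where
  "kernel_delta c q (s # y # xs) =
    (if q = 0 then (1, (s, Stay) # (3, Stay) # write_counters c 3)
     else if q = 1 then
       (if s = 2 then (1, (2, Move_Right) # (y, Move_Right) # write_counters c 2)
        else if s = 3 then (2, (3, Move_Right) # (y, Move_Right) # keep xs)
        else (3, keep (s # y # xs)))
     else if q = 2 then
       (if s = 2 then
          (case tick xs of
             None \<Rightarrow> (4, keep (s # y # xs))
           | Some acts \<Rightarrow> (2, (2, Move_Right) # (y, Move_Right) # acts))
        else (20, keep (s # y # xs)))
     else if q = 3 then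
       (case tick xs of
          None \<Rightarrow> (20, keep (s # y # xs))
        | Some acts \<Rightarrow> (3, (2, Move_Right) # (y, Stay) # acts))
     else if q = 4 then
       (if y = 3 then (5, keep (s # y # xs))
        else (4, (s, Move_Left) # (y, Move_Left) # keep xs))
     else if q < 19 then (Suc q, (triangle_code ! (q - 5), Move_Right) # (y, Stay) # keep xs)
     else if s = 0 then (20, keep (s # y # xs))
     else (19, (0, Move_Right) # (y, Stay) # keep xs))"
| "kernel_delta c q xs = (20, keep xs)"

definition kernel_tm :: "nat \<Rightarrow> tm" where
  "kernel_tm c = \<lparr>tm_tapes = 2 * c + 2, tm_symbols = 4, tm_states = 20, tm_delta = kernel_delta c\<rparr>"

lemma kernel_tm_simps [simp]:
  "tm_tapes (kernel_tm c) = 2 * c + 2" "tm_symbols (kernel_tm c) = 4"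
  "tm_states (kernel_tm c) = 20" "tm_delta (kernel_tm c) = kernel_delta c"
  by (simp_all add: kernel_tm_def)

lemma length_triangle_code [simp]: "length triangle_code = 14"
  by (simp add: triangle_code_def)

lemma set_triangle_code: "set triangle_code \<subseteq> {..<4}"
  by (simp add: triangle_code_def)

lemma tm_wf_kernel_tm: "tm_wf (kernel_tm c)"
  unfolding tm_wf_def
proof (intro conjI allI impI)
  fix q xs
  assume q: "q < tm_states (kernel_tm c)"
    and len: "length xs = tm_tapes (kernel_tm c)" and set: "set xs \<subseteq> {..<tm_symbols (kernel_tm c)}"
  obtain s y ys where xs: "xs = s # y # ys"
    using len by (cases xs; cases "tl xs") auto
  have ys: "length ys = 2 * c" "set ys \<subseteq> {..<4}" "s < 4" "y < 4" "even (length ys)"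
    using len set xs by auto
  have code: "triangle_code ! (q - 5) < 4" if "q < 19"
    using set_triangle_code nth_mem[of "q - 5" triangle_code] that by fastforce
  have "fst ` set (write_counters c 2) \<subseteq> {..<4}" "fst ` set (write_counters c 3) \<subseteq> {..<4}"
    using fst_set_write_counters[of c 2] fst_set_write_counters[of c 3] by auto
  moreover note tick_wf[OF _ ys(5,2)]
  ultimately show "case tm_delta (kernel_tm c) q xs of (q', acts) \<Rightarrow>
           q' \<le> tm_states (kernel_tm c) \<and> length acts = tm_tapes (kernel_tm c) \<and>
           fst ` set acts \<subseteq> {..<tm_symbols (kernel_tm c)}"
    using ys(1-4) q code by (simp add: xs split: option.split)
qed simp_all

section \<open>The phases of a run\<close>

lemma funpow_trans: "(f ^^ a) x = y \<Longrightarrow> (f ^^ b) y = z \<Longrightarrow> (f ^^ (a + b)) x = z"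
  by (simp add: add.commute[of a] funpow_add)

lemma tm_step_funpow:
  "tm_step M x = y \<Longrightarrow> (tm_step M ^^ b) y = z \<Longrightarrow> (tm_step M ^^ Suc b) x = z"
  by (simp add: funpow_swap1)

text \<open>The second tape holds only the marker 3 in cell 0, which is \<open>unary_tape 0\<close>.
  Its head position \<open>j\<close> is separate from \<open>i\<close>, as the two heads part once
  state 5 is reached.\<close>

definition kernel_config ::
  "nat \<Rightarrow> (nat \<Rightarrow> nat) \<Rightarrow> nat \<Rightarrow> nat \<Rightarrow> tape list \<Rightarrow> nat \<times> tape list" where
  "kernel_config q u i j ts = (q, (u, i) # (unary_tape 0, j) # ts)"

lemma kernel_tm_copy:
  assumes "\<And>j. j < k \<Longrightarrow> u j = 2" "i \<le> k"
  shows "(tm_step (kernel_tm c) ^^ Suc i) (0, (u, 0) # replicate (2 * c + 1) (tape_word [], 0)) =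
    kernel_config 1 u i i (counter_tapes i (replicate c (False, Suc i)))"
  using assms(2)
proof (induction i)
  case 0
  have "(tape_word [])(0 := 3) = unary_tape 0" by (auto simp: tape_word_def unary_tape_def)
  then show ?case
    by (simp add: tm_step_def kernel_config_def write_counters_blank[simplified])
next
  case (Suc i)
  have "u i = 2" using assms(1) Suc.prems by simp
  moreover from this have "u(i := 2) = u" by auto
  ultimately have "tm_step (kernel_tm c)
      (kernel_config 1 u i i (counter_tapes i (replicate c (False, Suc i)))) =
    kernel_config 1 u (Suc i) (Suc i) (counter_tapes (Suc i) (replicate c (False, Suc (Suc i))))"
    by (simp add: tm_step_def kernel_config_def write_counters_copy)
  then show ?case using Suc by simp
qed

text \<open>Stated for any \<open>r\<close> within the remaining ticks, to cover both outcomes: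
  \<open>r\<close> is the number of vertices if these end first, and all ticks otherwise.\<close>

lemma kernel_tm_count:
  assumes "\<And>j. i \<le> j \<Longrightarrow> j < i + r \<Longrightarrow> u j = 2" "r \<le> ticks_left (Suc k) cs"
    "snd ` set cs \<subseteq> {..Suc k}"
  shows "\<exists>cs'. (tm_step (kernel_tm c) ^^ r) (kernel_config 2 u i i (counter_tapes k cs)) =
      kernel_config 2 u (i + r) (i + r) (counter_tapes k cs') \<and>
      snd ` set cs' \<subseteq> {..Suc k} \<and> ticks_left (Suc k) cs' + r = ticks_left (Suc k) cs"
  using assms
proof (induction r arbitrary: i cs)
  case 0
  then show ?case by auto
next
  case (Suc r)
  obtain acts where acts: "tick (read_tapes (counter_tapes k cs)) = Some acts"
    using tick_eq_None_iff[OF Suc.prems(3)] Suc.prems(2) by fastforce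
  obtain cs1 where cs1: "map2 tape_act acts (counter_tapes k cs) = counter_tapes k cs1"
    "snd ` set cs1 \<subseteq> {..Suc k}" "Suc (ticks_left (Suc k) cs1) = ticks_left (Suc k) cs"
    using tick_counter_tapes[OF Suc.prems(3) acts] by blast
  have "u i = 2" using Suc.prems(1) by simp
  moreover from this have "u(i := 2) = u" by auto
  ultimately have step: "tm_step (kernel_tm c) (kernel_config 2 u i i (counter_tapes k cs)) =
      kernel_config 2 u (Suc i) (Suc i) (counter_tapes k cs1)"
    by (simp add: tm_step_def kernel_config_def acts cs1)
  obtain cs' where "(tm_step (kernel_tm c) ^^ r) (kernel_config 2 u (Suc i) (Suc i) (counter_tapes k cs1)) =
      kernel_config 2 u (Suc i + r) (Suc i + r) (counter_tapes k cs')"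
    "snd ` set cs' \<subseteq> {..Suc k}" "ticks_left (Suc k) cs' + r = ticks_left (Suc k) cs1"
    using Suc.IH[of "Suc i" cs1] Suc.prems cs1 by fastforce
  then show ?case using tm_step_funpow[OF step] cs1(3) by (intro exI[of _ cs']) simp
qed

lemma tape_word_append_upd: "(tape_word w)(length w := s) = tape_word (w @ [s])"
  by (auto simp: tape_word_def nth_append)

text \<open>The step beyond the \<open>r\<close> ticks is the one that finds the counters exhausted
  and halts.\<close>

lemma kernel_tm_fill:
  assumes "snd ` set cs \<subseteq> {..Suc k}" "ticks_left (Suc k) cs = r"
  shows "\<exists>i ts. (tm_step (kernel_tm c) ^^ Suc r)
      (kernel_config 3 (tape_word w) (length w) j (counter_tapes k cs)) =
    kernel_config 20 (tape_word (w @ replicate r 2)) i j ts"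
  using assms
proof (induction r arbitrary: w cs)
  case 0
  then have "tick (read_tapes (counter_tapes k cs)) = None" using tick_eq_None_iff by blast
  then show ?case
    by (intro exI[of _ "length w"] exI[of _ "counter_tapes k cs"])
       (simp add: tm_step_def kernel_config_def)
next
  case (Suc r)
  obtain acts where acts: "tick (read_tapes (counter_tapes k cs)) = Some acts"
    using tick_eq_None_iff[OF Suc.prems(1)] Suc.prems(2) by fastforce
  obtain cs1 where cs1: "map2 tape_act acts (counter_tapes k cs) = counter_tapes k cs1"
    "snd ` set cs1 \<subseteq> {..Suc k}" "Suc (ticks_left (Suc k) cs1) = ticks_left (Suc k) cs"
    using tick_counter_tapes[OF Suc.prems(1) acts] by blast
  have step: "tm_step (kernel_tm c) (kernel_config 3 (tape_word w) (length w) j (counter_tapes k cs)) =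
      kernel_config 3 (tape_word (w @ [2])) (length (w @ [2])) j (counter_tapes k cs1)"
    by (simp add: tm_step_def kernel_config_def acts cs1 tape_word_append_upd)
  obtain i ts where "(tm_step (kernel_tm c) ^^ Suc r)
      (kernel_config 3 (tape_word (w @ [2])) (length (w @ [2])) j (counter_tapes k cs1)) =
    kernel_config 20 (tape_word ((w @ [2]) @ replicate r 2)) i j ts"
    using Suc.IH[of cs1 "w @ [2]"] Suc.prems cs1 by auto
  from tm_step_funpow[OF step this] show ?case by auto
qed

text \<open>Both heads start on the same cell, so the marker on the second tape signals cell 0 of
  the first.\<close>

lemma kernel_tm_rewind:
  "(tm_step (kernel_tm c) ^^ Suc i) (kernel_config 4 u i i ts) = kernel_config 5 u 0 0 ts"
proof (induction i)
  case 0
  have "unary_tape 0 0 = 3" "(unary_tape 0)(0 := 3) = unary_tape 0"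
    by (auto simp: unary_tape_def)
  then show ?case by (simp add: tm_step_def kernel_config_def)
next
  case (Suc i)
  have "unary_tape 0 (Suc i) = 0" "(unary_tape 0)(Suc i := 0) = unary_tape 0"
    by (auto simp: unary_tape_def)
  then have "tm_step (kernel_tm c) (kernel_config 4 u (Suc i) (Suc i) ts) = kernel_config 4 u i i ts"
    by (simp add: tm_step_def kernel_config_def)
  then show ?case using Suc by (rule tm_step_funpow)
qed

lemma kernel_tm_write:
  assumes "i \<le> 14"
  shows "(tm_step (kernel_tm c) ^^ i) (kernel_config 5 u 0 j ts) =
    kernel_config (5 + i) (\<lambda>l. if l < i then triangle_code ! l else u l) i j ts"
  using assms
proof (induction i)
  case (Suc i)
  have "tm_step (kernel_tm c)
      (kernel_config (5 + i) (\<lambda>l. if l < i then triangle_code ! l else u l) i j ts) =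
    kernel_config (5 + Suc i) (\<lambda>l. if l < Suc i then triangle_code ! l else u l) (Suc i) j ts"
    using Suc.prems by (auto simp: tm_step_def kernel_config_def less_Suc_eq)
  then show ?case using Suc by simp
qed simp

text \<open>Erasing stops at the first blank; this clears the whole rest because encodings contain
  no 0.\<close>

lemma kernel_tm_erase:
  assumes "\<And>l. i \<le> l \<Longrightarrow> l < i + r \<Longrightarrow> u l \<noteq> 0" "u (i + r) = 0"
  shows "(tm_step (kernel_tm c) ^^ Suc r) (kernel_config 19 u i j ts) =
    kernel_config 20 (\<lambda>l. if i \<le> l \<and> l < i + r then 0 else u l) (i + r) j ts"
  using assms
proof (induction r arbitrary: i u)
  case 0
  then have "u i = 0" "u(i := 0) = u" by auto
  moreover have "(\<lambda>l. if i \<le> l \<and> l < i + 0 then 0 else u l) = u" by auto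
  ultimately show ?case by (simp add: tm_step_def kernel_config_def)
next
  case (Suc r)
  have step: "tm_step (kernel_tm c) (kernel_config 19 u i j ts) =
      kernel_config 19 (u(i := 0)) (Suc i) j ts"
    using Suc.prems(1)[of i] by (simp add: tm_step_def kernel_config_def)
  have "(tm_step (kernel_tm c) ^^ Suc r) (kernel_config 19 (u(i := 0)) (Suc i) j ts) =
    kernel_config 20 (\<lambda>l. if Suc i \<le> l \<and> l < Suc i + r then 0 else (u(i := 0)) l) (Suc i + r) j ts"
    using Suc.prems by (intro Suc.IH) auto
  moreover have "(\<lambda>l. if Suc i \<le> l \<and> l < Suc i + r then 0 else (u(i := 0)) l) =
      (\<lambda>l. if i \<le> l \<and> l < i + Suc r then 0 else u l)" by auto
  ultimately show ?case using tm_step_funpow[OF step] by simp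
qed

lemma kernel_tm_halt:
  "tm_outputs_within (kernel_tm c) w w' T"
  if "t \<le> T" "(tm_step (kernel_tm c) ^^ t) (0, (tape_word w, 0) # replicate (2 * c + 1) (tape_word [], 0)) =
    kernel_config 20 (tape_word w') i j ts"
  unfolding tm_outputs_within_def
  using that by (intro exI[of _ t]) (simp add: tm_init_def kernel_config_def)

section \<open>Complete runs on unary words and on encoded instances\<close>

text \<open>The same machine yields the computable size bound of the kernelization: after the
  \<open>k\<close> input symbols, it writes one symbol for each of the
  \<open>(k + 2) ^ c - 1\<close> ticks.\<close>

lemma computable_counter_power: "computable_nat_fun (\<lambda>k. k + ((k + 2) ^ c - 1))"
  unfolding computable_nat_fun_def
proof (intro exI[of _ "kernel_tm c"] conjI allI tm_wf_kernel_tm)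
  fix k
  let ?w = "replicate k 2" and ?cs = "replicate c (False, Suc k)"
  let ?r = "ticks_left (Suc k) ?cs"
  have "(tm_step (kernel_tm c) ^^ Suc k) (0, (tape_word ?w, 0) # replicate (2 * c + 1) (tape_word [], 0)) =
      kernel_config 1 (tape_word ?w) k k (counter_tapes k ?cs)"
    by (rule kernel_tm_copy) (auto simp: tape_word_def)
  moreover have "(tm_step (kernel_tm c) ^^ 1) (kernel_config 1 (tape_word ?w) k k (counter_tapes k ?cs)) =
      kernel_config 3 (tape_word ?w) (length ?w) k (counter_tapes k ?cs)"
  proof -
    have "tape_word ?w k = 0" by (simp add: tape_word_def)
    moreover from this have "(tape_word ?w)(k := 0) = tape_word ?w" by auto
    ultimately show ?thesis
      by (simp add: tm_step_def kernel_config_def)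
  qed
  moreover obtain i ts where "(tm_step (kernel_tm c) ^^ Suc ?r)
      (kernel_config 3 (tape_word ?w) (length ?w) k (counter_tapes k ?cs)) =
    kernel_config 20 (tape_word (?w @ replicate ?r 2)) i k ts"
    using kernel_tm_fill[of ?cs k ?r c ?w k] by auto
  ultimately have "(tm_step (kernel_tm c) ^^ (Suc k + 1 + Suc ?r))
      (0, (tape_word ?w, 0) # replicate (2 * c + 1) (tape_word [], 0)) =
    kernel_config 20 (tape_word (?w @ replicate ?r 2)) i k ts"
    using funpow_trans by metis
  moreover have "?r = (k + 2) ^ c - 1" using ticks_left_replicate[of "Suc k" c] by simp
  then have "?w @ replicate ?r 2 = replicate (k + ((k + 2) ^ c - 1)) (2::nat)"
    by (simp only: replicate_add)
  ultimately have "(tm_step (kernel_tm c) ^^ (Suc k + 1 + Suc ?r))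
      (0, (tape_word ?w, 0) # replicate (2 * c + 1) (tape_word [], 0)) =
    kernel_config 20 (tape_word (replicate (k + ((k + 2) ^ c - 1)) 2)) i k ts"
    by (simp only:)
  from kernel_tm_halt[OF order.refl this]
  show "\<exists>T. tm_outputs_within (kernel_tm c) ?w (replicate (k + ((k + 2) ^ c - 1)) 2) T" by blast
qed

text \<open>Every phase is a single pass over at most the word or the code of the triangle, so
  linear time suffices.\<close>

lemma kernel_tm_run:
  fixes k n :: nat and v :: "nat list"
  defines "w \<equiv> replicate k 2 @ [3] @ replicate n 2 @ [3] @ v"
  assumes v: "0 \<notin> set v"
  shows "tm_outputs_within (kernel_tm c) w (if n < (k + 2) ^ c then w else triangle_code)
           (20 * length w + 20)"
proof -
  let ?cs = "replicate c (False, Suc k)" and ?u = "tape_word w"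
  let ?init = "(0, (?u, 0) # replicate (2 * c + 1) (tape_word [], 0))"
  let ?R = "ticks_left (Suc k) ?cs"
  have R: "Suc ?R = (k + 2) ^ c" using ticks_left_replicate[of "Suc k" c] by simp
  have len: "length w = k + n + 2 + length v" by (simp add: w_def)
  have u2: "?u j = 2" if "j < k \<or> Suc k \<le> j \<and> j < Suc k + n" for j
    using that by (auto simp: tape_word_def w_def nth_append nth_Cons')
  have u3: "?u k = 3" "?u (Suc k + n) = 3"
    by (auto simp: tape_word_def w_def nth_append nth_Cons')
  have "(tm_step (kernel_tm c) ^^ Suc k) ?init = kernel_config 1 ?u k k (counter_tapes k ?cs)"
    using kernel_tm_copy[of k ?u k c] u2 by simp
  moreover have "(tm_step (kernel_tm c) ^^ 1) (kernel_config 1 ?u k k (counter_tapes k ?cs)) =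
      kernel_config 2 ?u (Suc k) (Suc k) (counter_tapes k ?cs)"
  proof -
    have "?u(k := 3) = ?u" using u3(1) by auto
    then show ?thesis using u3(1) by (simp add: tm_step_def kernel_config_def)
  qed
  ultimately have start: "(tm_step (kernel_tm c) ^^ (Suc k + 1)) ?init =
      kernel_config 2 ?u (Suc k) (Suc k) (counter_tapes k ?cs)"
    by (rule funpow_trans)
  show ?thesis
  proof (cases "n < (k + 2) ^ c")
    case True
    then have "n \<le> ?R" using R by simp
    then obtain cs' where "(tm_step (kernel_tm c) ^^ n)
        (kernel_config 2 ?u (Suc k) (Suc k) (counter_tapes k ?cs)) =
      kernel_config 2 ?u (Suc k + n) (Suc k + n) (counter_tapes k cs')"
      using kernel_tm_count[of "Suc k" n ?u k ?cs c] u2 by auto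
    note funpow_trans[OF start this]
    moreover have "(tm_step (kernel_tm c) ^^ 1)
        (kernel_config 2 ?u (Suc k + n) (Suc k + n) (counter_tapes k cs')) =
      kernel_config 20 ?u (Suc k + n) (Suc k + n) (counter_tapes k cs')"
    proof -
      have "?u(Suc k + n := 3) = ?u" using u3(2) by auto
      then show ?thesis using u3(2)
        by (simp add: tm_step_def kernel_config_def)
    qed
    ultimately have "(tm_step (kernel_tm c) ^^ (Suc k + 1 + n + 1)) ?init =
        kernel_config 20 ?u (Suc k + n) (Suc k + n) (counter_tapes k cs')"
      by (rule funpow_trans)
    from kernel_tm_halt[OF _ this, of "20 * length w + 20"] show ?thesis
      using True len by simp
  next
    case False
    \<comment> \<open>The inequality is strict, so when the ticks are used up the head still reads a
      vertex symbol 2 and not the separator; this is what leads to state 4.\<close>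
    then have n: "?R < n" using R by simp
    then obtain cs' where run: "(tm_step (kernel_tm c) ^^ ?R)
        (kernel_config 2 ?u (Suc k) (Suc k) (counter_tapes k ?cs)) =
      kernel_config 2 ?u (Suc k + ?R) (Suc k + ?R) (counter_tapes k cs')"
      and cs': "snd ` set cs' \<subseteq> {..Suc k}" "ticks_left (Suc k) cs' = 0"
      using kernel_tm_count[of "Suc k" ?R ?u k ?cs c] u2 by auto
    note funpow_trans[OF start run]
    moreover have "(tm_step (kernel_tm c) ^^ 1)
        (kernel_config 2 ?u (Suc k + ?R) (Suc k + ?R) (counter_tapes k cs')) =
      kernel_config 4 ?u (Suc k + ?R) (Suc k + ?R) (counter_tapes k cs')"
    proof -
      have "?u (Suc k + ?R) = 2" using u2 n by simp
      moreover from this have "?u(Suc k + ?R := 2) = ?u" by auto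
      moreover have "tick (read_tapes (counter_tapes k cs')) = None"
        using tick_eq_None_iff[OF cs'(1)] cs'(2) by simp
      ultimately show ?thesis
        by (simp add: tm_step_def kernel_config_def)
    qed
    ultimately have "(tm_step (kernel_tm c) ^^ (Suc k + 1 + ?R + 1)) ?init =
        kernel_config 4 ?u (Suc k + ?R) (Suc k + ?R) (counter_tapes k cs')"
      by (rule funpow_trans)
    note funpow_trans[OF this kernel_tm_rewind]
    note funpow_trans[OF this kernel_tm_write[OF order.refl]]
    then have written: "(tm_step (kernel_tm c) ^^ (Suc k + 1 + ?R + 1 + Suc (Suc k + ?R) + 14)) ?init =
        kernel_config 19 (\<lambda>l. if l < 14 then triangle_code ! l else ?u l) 14 0 (counter_tapes k cs')"
      by simp
    \<comment> \<open>Truncated subtraction is right here: a word shorter than the code leaves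
      nothing to erase.\<close>
    let ?u' = "\<lambda>l. if l < 14 then triangle_code ! l else ?u l" and ?r = "length w - 14"
    have "0 \<notin> set w" using v by (auto simp: w_def)
    then have nz: "?u l \<noteq> 0" if "l < length w" for l
      using that by (metis tape_word_def nth_mem)
    have "(tm_step (kernel_tm c) ^^ Suc ?r) (kernel_config 19 ?u' 14 0 (counter_tapes k cs')) =
      kernel_config 20 (\<lambda>l. if 14 \<le> l \<and> l < 14 + ?r then 0 else ?u' l) (14 + ?r) 0 (counter_tapes k cs')"
      using nz by (intro kernel_tm_erase) (auto simp: tape_word_def)
    moreover have "(\<lambda>l. if 14 \<le> l \<and> l < 14 + ?r then 0 else ?u' l) = tape_word triangle_code"
      by (auto simp: fun_eq_iff tape_word_def)
    ultimately have "(tm_step (kernel_tm c) ^^ (Suc k + 1 + ?R + 1 + Suc (Suc k + ?R) + 14 + Suc ?r)) ?init =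
        kernel_config 20 (tape_word triangle_code) (14 + ?r) 0 (counter_tapes k cs')"
      using funpow_trans[OF written] by (simp only:)
    from kernel_tm_halt[OF _ this, of "20 * length w + 20"] show ?thesis
      using False len n by simp
  qed
qed

section \<open>The kernel\<close>

lemma enc_instance_eq:
  "enc_instance ((V, E), k) = replicate k 2 @ [3] @ replicate (card V) 2 @ [3] @
     concat (map (\<lambda>i. map (\<lambda>j. if {i, j} \<in> E then 2 else 1) [0..<card V]) [0..<card V])"
  by (simp add: enc_instance_def Let_def)

lemma length_enc_instance: "length (enc_instance ((V, E), k)) = k + card V + 2 + card V * card V"
  by (simp add: enc_instance_eq length_concat comp_def sum_list_triv)

text \<open>The threshold uses \<open>k + 2\<close> instead of \<open>k\<close> because this is the
  number of head positions on a counter tape.\<close>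

definition kernel :: "nat graph \<times> nat \<Rightarrow> nat graph \<times> nat" where
  "kernel x = (if card (fst (fst x)) < (snd x + 2) ^ 3 then x else (triangle_graph, 0))"

lemma triangle_instance: "(triangle_graph, 0) \<in> planar_mindeg2_instances"
  using planar_triangle triangle_mindeg
  by (simp add: planar_mindeg2_instances_def) (simp add: triangle_graph_def)

lemma LMDA_if_many_vertices:
  assumes "((V, E), k) \<in> planar_mindeg2_instances" "k ^ 3 < card V"
  shows "((V, E), k) \<in> LMDA"
proof (rule ccontr)
  assume "((V, E), k) \<notin> LMDA"
  then have "card V \<le> k ^ 3"
    using assms(1)
    by (intro card_le_cube_if_no_large_alliance[of V E])
       (auto simp: LMDA_def planar_mindeg2_instances_def not_le)
  then show False using assms(2) by simp
qed

lemma kernelization_kernel: "kernelization enc_instance planar_mindeg2_instances LMDA kernel"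
  unfolding kernelization_def
proof (intro conjI ballI)
  show "poly_time_computable_on enc_instance planar_mindeg2_instances kernel"
    unfolding poly_time_computable_on_def
  proof (rule exI[of _ "kernel_tm 3"], rule exI[of _ 20], rule exI[of _ 1],
      intro conjI ballI tm_wf_kernel_tm)
    fix x :: "nat graph \<times> nat"
    obtain V E k where x: "x = ((V, E), k)" by (metis prod.exhaust)
    let ?v = "concat (map (\<lambda>i. map (\<lambda>j. if {i, j} \<in> E then 2::nat else 1) [0..<card V]) [0..<card V])"
    have "0 \<notin> set ?v" by auto
    from kernel_tm_run[OF this, of 3 k "card V"]
    have "tm_outputs_within (kernel_tm 3) (enc_instance x)
        (if card V < (k + 2) ^ 3 then enc_instance x else triangle_code)
        (20 * length (enc_instance x) + 20)"
      by (simp only: x enc_instance_eq)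
    moreover have "(if card V < (k + 2) ^ 3 then enc_instance x else triangle_code) =
        enc_instance (kernel x)"
      by (simp add: kernel_def x enc_triangle)
    ultimately show "tm_outputs_within (kernel_tm 3) (enc_instance x) (enc_instance (kernel x))
        (20 * length (enc_instance x) ^ 1 + 20)"
      by simp
  qed
next
  fix x :: "nat graph \<times> nat" assume x: "x \<in> planar_mindeg2_instances"
  show "kernel x \<in> planar_mindeg2_instances"
    using x triangle_instance by (simp add: kernel_def)
  obtain V E k where x_eq: "x = ((V, E), k)" by (metis prod.exhaust)
  have "x \<in> LMDA" if "(k + 2) ^ 3 \<le> card V"
  proof -
    have "k ^ 3 < (k + 2) ^ 3" by (rule power_strict_mono) auto
    then show ?thesis using LMDA_if_many_vertices x that unfolding x_eq by simp
  qed
  \<comment> \<open>The triangle has more than \<open>0 ^ 3\<close> vertices, so the criterion for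
    large instances applies to it too.\<close>
  moreover have "(triangle_graph, 0) \<in> LMDA"
    using LMDA_if_many_vertices[of "fst triangle_graph" "snd triangle_graph" 0] triangle_instance
    by (simp add: triangle_graph_def)
  ultimately show "kernel x \<in> LMDA \<longleftrightarrow> x \<in> LMDA"
    by (auto simp: kernel_def x_eq not_less)
next
  show "\<exists>g. computable_nat_fun g \<and>
      (\<forall>x\<in>planar_mindeg2_instances. length (enc_instance (kernel x)) \<le> g (snd x))"
  proof (intro exI conjI ballI)
    \<comment> \<open>The adjacency matrix has fewer than \<open>(k + 2) ^ 6\<close> entries; one
      further factor absorbs the remaining symbols, the subtracted 1 and the 14 symbols of the
      triangle.\<close>
    show "computable_nat_fun (\<lambda>k. k + ((k + 2) ^ 7 - 1))" by (rule computable_counter_power)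
    fix x :: "nat graph \<times> nat"
    obtain V E k where x: "x = ((V, E), k)" by (metis prod.exhaust)
    let ?N = "(k + 2) ^ 3"
    have N: "8 \<le> ?N" using power_mono[of 2 "k + 2" 3] by simp
    have "?N * ?N + 64 \<le> 2 * (?N * ?N)" using mult_mono[OF N N] by simp
    also have "\<dots> \<le> (k + 2) * (?N * ?N)" by (rule mult_right_mono) auto
    also have "\<dots> = (k + 2) ^ 7"
    proof -
      have "a * (a ^ 3 * a ^ 3) = a ^ 7" for a :: nat by (simp add: power_numeral_reduce)
      then show ?thesis .
    qed
    finally have pow: "?N * ?N + 64 \<le> (k + 2) ^ 7" .
    show "length (enc_instance (kernel x)) \<le> snd x + ((snd x + 2) ^ 7 - 1)"
    proof (cases "card V < ?N")
      case True
      then have "card V + 1 \<le> ?N" by simp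
      then have "(card V + 1) * (card V + 1) \<le> ?N * ?N" by (intro mult_mono) auto
      moreover have "(card V + 1) * (card V + 1) = card V * card V + 2 * card V + 1" by simp
      ultimately have "card V * card V + card V + 2 + 1 \<le> (k + 2) ^ 7" using pow by linarith
      then show ?thesis using True by (simp add: kernel_def x length_enc_instance)
    next
      case False
      then show ?thesis using pow by (simp add: kernel_def x enc_triangle)
    qed
  qed
qed

theorem theorem6:
  "\<exists>(f :: nat \<Rightarrow> nat) (e :: nat \<Rightarrow> real).
     e \<in> O(\<lambda>k. real k ^ 4) \<and>
     (\<forall>\<^sub>F k in sequentially. real (f k) \<le> real k powr e k) \<and>
     admits_kernel_with_vertices planar_mindeg2_instances LMDA f"
proof (intro exI conjI)
  show "(\<lambda>k. real k ^ 4) \<in> O(\<lambda>k. real k ^ 4)" by simp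
  show "\<forall>\<^sub>F k in sequentially. real ((k + 2) ^ 3) \<le> real k powr (real k ^ 4)"
  \<comment> \<open>From 2 on, \<open>k + 2 \<le> k * k\<close>, so the cube is at most
    \<open>k ^ 6\<close>, and \<open>6 \<le> 16 \<le> k ^ 4\<close>.\<close>
  proof (rule eventually_sequentiallyI[of 2])
    fix k :: nat assume k: "2 \<le> k"
    have "k + 2 \<le> k * k" using mult_mono[OF k order.refl, of k] k by linarith
    then have "(k + 2) ^ 3 \<le> (k * k) ^ 3" by (rule power_mono) simp
    also have "\<dots> = k ^ 6" by (simp add: power_numeral_reduce)
    also have "\<dots> \<le> k ^ (k ^ 4)"
      using k power_mono[OF k, of 4] by (intro power_increasing) auto
    finally have "real ((k + 2) ^ 3) \<le> real (k ^ (k ^ 4))" by (rule of_nat_mono)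
    also have "\<dots> = real k powr real (k ^ 4)" using k by (subst powr_realpow) auto
    finally show "real ((k + 2) ^ 3) \<le> real k powr (real k ^ 4)" by simp
  qed
  have "card (fst (fst (kernel (G, k)))) \<le> (k + 2) ^ 3" for G k
  proof -
    \<comment> \<open>This covers the three vertices of the triangle.\<close>
    have "8 \<le> (k + 2) ^ 3" using power_mono[of 2 "k + 2" 3] by simp
    then show ?thesis by (auto simp: kernel_def triangle_graph_def)
  qed
  then show "admits_kernel_with_vertices planar_mindeg2_instances LMDA (\<lambda>k. (k + 2) ^ 3)"
    unfolding admits_kernel_with_vertices_def using kernelization_kernel by blast
qed

end
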